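(* Let $k\in\mathbb{N}$ and $n_1,\dots,n_k\in\{2,3,4,\dots\}$ with $n_1-1\mid n_j-1$ for all $j\in\{1,\dots,k\}$. There exists a fixed $B\in\mathbb{N}$, $B\ge2$, such that for all $x\in F(n_1,\dots,n_k)$, $$|x|_X\ge\log_B L(x).$$
   Context: $F(n_1,\dots,n_k)$ is the group (product $xy=x\circ y$) of piecewise-linear orientation-preserving homeomorphisms of $[0,1]$ with finitely many breakpoints, all in $\mathbb{Z}[\frac{1}{n_1\cdots n_k}]$, and slopes in the multiplicative group $\langle n_1,\dots,n_k\rangle$. An $n$-ary caret (caret of type $n$) has one parent vertex joined by $n$ edges to $n$ child vertices, ordered from left to right. An $(n_1,\dots,n_k)$-ary tree is a rooted tree formed from finitely many (possibly zero) carets of types in $\{n_1,\dots,n_k\}$ by identifying child vertices of carets with parent vertices of other carets. Leaves are numbered $0,1,2,\dots$ from left to right. The root represents $[0,1]$, and the children of an $n$-ary caret represent, from left to right, the $n$ equal consecutive closed subintervals of the parent's interval. A tree-pair diagram $(T_-,T_+)$ is an ordered pair of such trees with equally many leaves (domain tree $T_-$, range tree $T_+$); it represents the element mapping the $i$th leaf interval of $T_-$ affinely and increasingly onto the $i$th leaf interval of $T_+$, for all $i$. Every element is represented by some diagram. A diagram is minimal if it has the fewest leaves among all diagrams representing the same element; $L(x)$ is the number of leaves in either tree of a minimal diagram for $x$. Generators. A right $n_1$-string is a tree all of whose carets are of type $n_1$ and have an edge on the rightmost root-to-leaf path. For $j\in\{2,\dots,k\}$, $i\ge0$, $(y_j)_i$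 has range tree a right $n_1$-string of $i$ carets with an $n_j$-ary caret attached to its last leaf, and domain tree the right $n_1$-string with the same number of leaves. For $j\in\{1,\dots,k\}$, $i\ge 0$, $(z_j)_i$ has range tree a right $n_1$-string of $\lfloor i/(n_1-1)\rfloor+1$ carets with an $n_j$-ary caret attached to the leaf numbered $i$, and domain tree the right $n_1$-string with the same number of leaves. The standard finite generating set is $X=\{(y_i)_0,\dots,(y_i)_{n_i-1}: 2\le i\le k\}\cup\{(z_j)_0,\dots,(z_j)_{n_j-1}:1\le j\le k\}$, and $|x|_X$ is the word length of $x$ with respect to $X$. *)

theory Defs
  imports "HOL-Analysis.Analysis" "HOL-Algebra.Bij"
begin

text \<open>The parameters \<open>n\<^sub>1, \<dots>, n\<^sub>k\<close> are the values \<open>n 1, \<dots>, n k\<close> of a function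
  \<open>n :: nat \<Rightarrow> nat\<close>; its other values are never used.\<close>

section \<open>The group\<close>

definition localized_ints :: "nat \<Rightarrow> real set" where
  "localized_ints N = {of_int p / real N ^ e | (p :: int) (e :: nat). True}"

definition slope_group :: "nat \<Rightarrow> (nat \<Rightarrow> nat) \<Rightarrow> real set" where
  "slope_group k n = {\<Prod>j=1..k. real (n j) powi e j | e :: nat \<Rightarrow> int. True}"

text \<open>\<open>S\<close> contains all breakpoints. Membership in \<^const>\<open>Bij\<close> makes the map undefined outside
  the unit interval, so that elements are determined by their values on the interval.
  The product of \<^const>\<open>BijGroup\<close> is composition, \<open>x y = x \<circ> y\<close>.\<close>

definition F_group :: "nat \<Rightarrow> (nat \<Rightarrow> nat) \<Rightarrow> (real \<Rightarrow> real) monoid" where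
  "F_group k n = (BijGroup {0..1}) \<lparr>carrier :=
     {f \<in> Bij {0..1}.
        (\<exists>g. homeomorphism {0..1} {0..1} f g) \<and> strict_mono_on {0..1} f \<and>
        (\<exists>S. finite S \<and> S \<subseteq> localized_ints (\<Prod>j=1..k. n j) \<and>
           (\<forall>a b. 0 \<le> a \<and> a < b \<and> b \<le> 1 \<and> {a<..<b} \<inter> S = {} \<longrightarrow>
              (\<exists>s\<in>slope_group k n. \<exists>c. \<forall>x\<in>{a..b}. f x = s * x + c)))}\<rparr>"


section \<open>Trees and tree-pair diagrams\<close>

text \<open>\<open>Caret ts\<close> is a root caret of type \<^term>\<open>length ts\<close>, with the tree \<open>ts ! i\<close> hanging
  from its \<open>i\<close>th child.\<close>

datatype tree = Leaf | Caret "tree list"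

fun nary_tree :: "nat set \<Rightarrow> tree \<Rightarrow> bool" where
  "nary_tree N Leaf \<longleftrightarrow> True"
| "nary_tree N (Caret ts) \<longleftrightarrow> length ts \<in> N \<and> (\<forall>t\<in>set ts. nary_tree N t)"

primrec num_leaves :: "tree \<Rightarrow> nat" where
  "num_leaves Leaf = 1"
| "num_leaves (Caret ts) = sum_list (map num_leaves ts)"

text \<open>\<open>leaf_intervals T a w\<close> lists the endpoints of the leaf intervals of \<open>T\<close> from left to right
  when the root represents \<open>[a, a + w]\<close>; in \<open>leaf_intervals_list\<close> the consecutive trees of the
  list each get an interval of width \<open>w\<close>, the first one starting at \<open>a\<close>.\<close>

fun leaf_intervals :: "tree \<Rightarrow> real \<Rightarrow> real \<Rightarrow> (real \<times> real) list"
  and leaf_intervals_list :: "tree list \<Rightarrow> real \<Rightarrow> real \<Rightarrow> (real \<times> real) list" where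
  "leaf_intervals Leaf a w = [(a, a + w)]"
| "leaf_intervals (Caret ts) a w = leaf_intervals_list ts a (w / real (length ts))"
| "leaf_intervals_list [] a w = []"
| "leaf_intervals_list (t # ts) a w = leaf_intervals t a w @ leaf_intervals_list ts (a + w) w"

definition tree_pair :: "nat \<Rightarrow> (nat \<Rightarrow> nat) \<Rightarrow> tree \<Rightarrow> tree \<Rightarrow> bool" where
  "tree_pair k n T S \<longleftrightarrow>
     nary_tree (n ` {1..k}) T \<and> nary_tree (n ` {1..k}) S \<and> num_leaves T = num_leaves S"

text \<open>The domain tree comes first.\<close>

definition represents :: "tree \<Rightarrow> tree \<Rightarrow> (real \<Rightarrow> real) \<Rightarrow> bool" where
  "represents T S f \<longleftrightarrow> f \<in> extensional {0..1} \<and>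
     (\<forall>i < num_leaves T. \<forall>t \<in> {0..1}.
        let (a, b) = leaf_intervals T 0 1 ! i; (c, d) = leaf_intervals S 0 1 ! i
        in f (a + t * (b - a)) = c + t * (d - c))"

definition minimal_diagram ::
    "nat \<Rightarrow> (nat \<Rightarrow> nat) \<Rightarrow> (real \<Rightarrow> real) \<Rightarrow> tree \<Rightarrow> tree \<Rightarrow> bool" where
  "minimal_diagram k n x T S \<longleftrightarrow> tree_pair k n T S \<and> represents T S x \<and>
     (\<forall>T' S'. tree_pair k n T' S' \<and> represents T' S' x \<longrightarrow> num_leaves T \<le> num_leaves T')"

definition min_leaves :: "nat \<Rightarrow> (nat \<Rightarrow> nat) \<Rightarrow> (real \<Rightarrow> real) \<Rightarrow> nat" where
  "min_leaves k n x = (THE l. \<exists>T S. minimal_diagram k n x T S \<and> num_leaves T = l)"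


section \<open>The standard finite generating set\<close>

text \<open>\<open>right_string m i\<close> is the right \<open>m\<close>-string of \<open>i\<close> carets.\<close>

primrec right_string :: "nat \<Rightarrow> nat \<Rightarrow> tree" where
  "right_string m 0 = Leaf"
| "right_string m (Suc i) = Caret (replicate (m - 1) Leaf @ [right_string m i])"

text \<open>\<open>attach_caret m T i\<close> attaches an \<open>m\<close>-ary caret to the leaf of \<open>T\<close> numbered \<open>i\<close>
  (leaves are numbered from 0).\<close>

fun attach_caret :: "nat \<Rightarrow> tree \<Rightarrow> nat \<Rightarrow> tree"
  and attach_caret_list :: "nat \<Rightarrow> tree list \<Rightarrow> nat \<Rightarrow> tree list" where
  "attach_caret m Leaf i = (if i = 0 then Caret (replicate m Leaf) else Leaf)"
| "attach_caret m (Caret ts) i = Caret (attach_caret_list m ts i)"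
| "attach_caret_list m [] i = []"
| "attach_caret_list m (t # ts) i =
     (if i < num_leaves t then attach_caret m t i # ts
      else t # attach_caret_list m ts (i - num_leaves t))"

text \<open>A right \<open>m\<close>-string of \<open>i\<close> carets has \<open>i * (m - 1) + 1\<close> leaves, so the domain tree below is
  the right \<open>n\<^sub>1\<close>-string with as many leaves as \<open>S\<close>; it exists because \<open>n\<^sub>1 - 1\<close> divides every
  \<open>n\<^sub>j - 1\<close>.\<close>

definition string_to :: "(nat \<Rightarrow> nat) \<Rightarrow> tree \<Rightarrow> (real \<Rightarrow> real)" where
  "string_to n S =
     (THE f. represents (right_string (n 1) ((num_leaves S - 1) div (n 1 - 1))) S f)"

definition y_gen :: "(nat \<Rightarrow> nat) \<Rightarrow> nat \<Rightarrow> nat \<Rightarrow> (real \<Rightarrow> real)" where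
  "y_gen n j i = string_to n
     (let R = right_string (n 1) i in attach_caret (n j) R (num_leaves R - 1))"

definition z_gen :: "(nat \<Rightarrow> nat) \<Rightarrow> nat \<Rightarrow> nat \<Rightarrow> (real \<Rightarrow> real)" where
  "z_gen n j i = string_to n
     (attach_caret (n j) (right_string (n 1) (i div (n 1 - 1) + 1)) i)"

definition standard_gens :: "nat \<Rightarrow> (nat \<Rightarrow> nat) \<Rightarrow> (real \<Rightarrow> real) set" where
  "standard_gens k n = {y_gen n j i | j i. j \<in> {2..k} \<and> i < n j}
                     \<union> {z_gen n j i | j i. j \<in> {1..k} \<and> i < n j}"


section \<open>Word length\<close>

text \<open>The value is \<open>\<infinity>\<close> exactly if \<open>x\<close> is not a product of elements of \<open>X\<close> and their inverses.\<close>

definition word_length :: "('a, 'b) monoid_scheme \<Rightarrow> 'a set \<Rightarrow> 'a \<Rightarrow> enat" where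
  "word_length G X x =
     (INF w \<in> {w. set w \<subseteq> X \<union> m_inv G ` X \<and> foldr (mult G) w (one G) = x}. enat (length w))"

end

theory Submission
  imports Defs
begin

text \<open>Multiplying by a fixed element \<open>g\<close> increases the number of leaves by at most a constant
  factor. If \<open>(T', S')\<close> represents \<open>g\<close> and \<open>(T, S)\<close> represents \<open>f\<close>, a diagram of \<open>g \<circ> f\<close> arises
  from any common refinement of \<open>S\<close> and \<open>T'\<close>, so it suffices to bound the size of such a refinement
  linearly in the size of \<open>S\<close>. For a single \<open>m\<close>-caret \<open>T'\<close>, attach an \<open>m\<close>-caret to every leaf of
  \<open>S\<close>: these carets can be moved up to the root without changing the leaf intervals, and the
  number of leaves is multiplied by \<open>m\<close>. Recursion into the \<open>m\<close> subtrees handles general \<open>T'\<close>.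
  Taking \<open>B\<close> above the constants of all generators and their inverses bounds the leaves of a
  product of \<open>l\<close> of them by \<open>B\<^sup>l\<close>.\<close>

section \<open>Grafting and subdividing\<close>

text \<open>The list holds one tree per leaf, from left to right, and each child takes the segment
  belonging to its own leaves. The lemmas below assume that the lengths match, so that
  \<open>hd us\<close> is never taken of an empty list.\<close>

fun graft :: "tree \<Rightarrow> tree list \<Rightarrow> tree"
  and graft_list :: "tree list \<Rightarrow> tree list \<Rightarrow> tree list" where
  "graft Leaf us = hd us"
| "graft (Caret ts) us = Caret (graft_list ts us)"
| "graft_list [] us = []"
| "graft_list (t # ts) us =
     graft t (take (num_leaves t) us) # graft_list ts (drop (num_leaves t) us)"

text \<open>The counterpart of \<open>graft\<close> for bare lists of intervals: each interval is
  treated as the root of its tree. Since no tree stands behind the list, refinements of different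
  trees can be compared as partitions.\<close>

fun subdivide :: "(real \<times> real) list \<Rightarrow> tree list \<Rightarrow> (real \<times> real) list" where
  "subdivide (I # Is) (u # us) = leaf_intervals u (fst I) (snd I - fst I) @ subdivide Is us"
| "subdivide _ _ = []"

lemma subdivide_append:
  "length Is = length us \<Longrightarrow> subdivide (Is @ Js) (us @ vs) = subdivide Is us @ subdivide Js vs"
  by (induction Is us rule: list_induct2) auto

lemma length_leaf_intervals [simp]: "length (leaf_intervals t a w) = num_leaves t"
  and length_leaf_intervals_list [simp]:
    "length (leaf_intervals_list ts a w) = sum_list (map num_leaves ts)"
  by (induction t a w and ts a w rule: leaf_intervals_leaf_intervals_list.induct) auto

lemma length_subdivide:
  "length Is = length us \<Longrightarrow> length (subdivide Is us) = sum_list (map num_leaves us)"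
  by (induction Is us rule: list_induct2) auto

lemma length_graft_list [simp]: "length (graft_list ts us) = length ts"
  by (induction ts arbitrary: us) auto

text \<open>A leaf interval records both the start and the width of its leaf, which is all that the
  grafted tree needs to know.\<close>

lemma leaf_intervals_graft:
  "length us = num_leaves t \<Longrightarrow>
    leaf_intervals (graft t us) a w = subdivide (leaf_intervals t a w) us"
  and leaf_intervals_graft_list:
  "length us = sum_list (map num_leaves ts) \<Longrightarrow>
    leaf_intervals_list (graft_list ts us) a w = subdivide (leaf_intervals_list ts a w) us"
proof (induction t a w and ts a w arbitrary: us and us
    rule: leaf_intervals_leaf_intervals_list.induct)
  case (1 a w)
  then show ?case by (cases us) auto
next
  case (4 t ts a w)
  have "subdivide (leaf_intervals t a w @ leaf_intervals_list ts (a + w) w)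
          (take (num_leaves t) us @ drop (num_leaves t) us) =
        subdivide (leaf_intervals t a w) (take (num_leaves t) us) @
        subdivide (leaf_intervals_list ts (a + w) w) (drop (num_leaves t) us)"
    by (rule subdivide_append) (use 4 in auto)
  then show ?case using 4 by simp
qed auto

lemma num_leaves_graft:
  "length us = num_leaves t \<Longrightarrow> num_leaves (graft t us) = sum_list (map num_leaves us)"
  by (metis leaf_intervals_graft length_leaf_intervals length_subdivide)

text \<open>Used to replace a refinement made in two stages by trees hung directly on the leaves of
  the original tree.\<close>

lemma subdivide_subdivide:
  assumes "length Is = length us" "length vs = sum_list (map num_leaves us)"
  shows "subdivide (subdivide Is us) vs = subdivide Is (graft_list us vs)"
  using assms
proof (induction Is us arbitrary: vs rule: list_induct2)
  case (Cons I Is u us)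
  have "subdivide (leaf_intervals u (fst I) (snd I - fst I) @ subdivide Is us)
          (take (num_leaves u) vs @ drop (num_leaves u) vs) =
        subdivide (leaf_intervals u (fst I) (snd I - fst I)) (take (num_leaves u) vs) @
        subdivide (subdivide Is us) (drop (num_leaves u) vs)"
    by (rule subdivide_append) (use Cons in auto)
  then show ?case using Cons by (simp add: leaf_intervals_graft)
qed auto

lemma nary_graft:
  "nary_tree N t \<Longrightarrow> length us = num_leaves t \<Longrightarrow> \<forall>u\<in>set us. nary_tree N u \<Longrightarrow>
    nary_tree N (graft t us)"
  and nary_graft_list:
  "\<forall>t\<in>set ts. nary_tree N t \<Longrightarrow> length us = sum_list (map num_leaves ts) \<Longrightarrow>
    \<forall>u\<in>set us. nary_tree N u \<Longrightarrow> \<forall>u\<in>set (graft_list ts us). nary_tree N u"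
proof (induction t us and ts us rule: graft_graft_list.induct)
  case (1 us)
  then show ?case by (cases us) simp_all
next
  case (2 ts us)
  have "\<forall>u\<in>set (graft_list ts us). nary_tree N u"
    by (rule 2(1)) (use 2(2-) in simp_all)
  then show ?case using 2(2) by simp
next
  case (3 us)
  then show ?case by simp
next
  case (4 t ts us)
  have "nary_tree N (graft t (take (num_leaves t) us))"
    by (rule 4(1)) (use 4(3-) in \<open>auto dest: in_set_takeD\<close>)
  moreover have "\<forall>u\<in>set (graft_list ts (drop (num_leaves t) us)). nary_tree N u"
    by (rule 4(2)) (use 4(3-) in \<open>auto dest: in_set_dropD\<close>)
  ultimately show ?case by simp
qed


section \<open>Common refinements\<close>

lemma leaf_intervals_list_append:
  "leaf_intervals_list (ts @ us) a w =
    leaf_intervals_list ts a w @ leaf_intervals_list us (a + real (length ts) * w) w"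
  by (induction ts arbitrary: a) (simp_all add: distrib_right add.assoc)

text \<open>A row of trees with equal widths does not remember how it was grouped into carets. Two
  groupings of one row can therefore be exchanged.\<close>

lemma leaf_intervals_list_carets:
  assumes "\<forall>ts\<in>set tss. length ts = q" "q > 0"
  shows "leaf_intervals_list (map Caret tss) a w =
    leaf_intervals_list (concat tss) a (w / real q)"
  using assms
proof (induction tss arbitrary: a)
  case (Cons ts tss)
  then have "leaf_intervals_list (map Caret tss) (a + w) w =
      leaf_intervals_list (concat tss) (a + w) (w / real q)" by simp
  moreover have "length ts = q" "real q * (w / real q) = w" using Cons.prems by auto
  ultimately show ?case by (simp only: leaf_intervals_list_append list.map concat.simps
        leaf_intervals.simps leaf_intervals_list.simps)
qed simp

lemma list_into_chunks:
  "length xs = m * p \<Longrightarrow>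
    \<exists>yss. length yss = m \<and> (\<forall>ys\<in>set yss. length ys = p) \<and> concat yss = xs"
proof (induction m arbitrary: xs)
  case (Suc m)
  obtain yss where "length yss = m" "\<forall>ys\<in>set yss. length ys = p" "concat yss = drop p xs"
    using Suc.IH[of "drop p xs"] Suc.prems by auto
  then have "length (take p xs # yss) = Suc m"
    and "\<forall>ys\<in>set (take p xs # yss). length ys = p" and "concat (take p xs # yss) = xs"
    using Suc.prems by simp_all
  then show ?case by blast
qed simp

text \<open>Assembles refinements of the single trees into one of the whole row. The hypothesis is
  for all \<open>a\<close> and \<open>w\<close> because each tree of the row starts at a different
  point.\<close>

lemma leaf_intervals_list_concat_subdivide:
  assumes "length ts = length us" "length uss = length us"
    and "\<And>i a w. i < length ts \<Longrightarrow>
          leaf_intervals (us ! i) a w = subdivide (leaf_intervals (ts ! i) a w) (uss ! i)"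
    and "\<And>i. i < length ts \<Longrightarrow> length (uss ! i) = num_leaves (ts ! i)"
  shows "leaf_intervals_list us a w = subdivide (leaf_intervals_list ts a w) (concat uss)"
  using assms
proof (induction ts us arbitrary: a uss rule: list_induct2)
  case (Cons t ts u us)
  obtain vs vss where uss: "uss = vs # vss" using Cons.prems(1) by (cases uss) auto
  have "leaf_intervals_list us (a + w) w =
      subdivide (leaf_intervals_list ts (a + w) w) (concat vss)"
  proof (rule Cons.IH)
    show "leaf_intervals (us ! i) a w = subdivide (leaf_intervals (ts ! i) a w) (vss ! i)"
      if "i < length ts" for i a w
      using Cons.prems(2)[of "Suc i"] that by (simp add: uss)
    show "length (vss ! i) = num_leaves (ts ! i)" if "i < length ts" for i
      using Cons.prems(3)[of "Suc i"] that by (simp add: uss)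
  qed (use Cons.prems in \<open>simp add: uss\<close>)
  moreover have "leaf_intervals u a w = subdivide (leaf_intervals t a w) vs"
      and "length vs = num_leaves t"
    using Cons.prems(2)[of 0] Cons.prems(3)[of 0] by (auto simp: uss)
  ultimately show ?case by (simp add: uss subdivide_append)
qed auto

text \<open>The \<open>p\<close> children of the root, each cut into \<open>m\<close> equal parts, give the same \<open>p * m\<close> intervals
  as an \<open>m\<close>-caret at the root with \<open>p\<close>-carets at its leaves.\<close>

lemma carets_at_leaves_to_root:
  assumes "m \<in> N" "\<forall>q\<in>N. q > 0" "nary_tree N t"
  shows "\<exists>ss. length ss = m \<and> (\<forall>s\<in>set ss. nary_tree N s) \<and>
    (\<forall>a w. leaf_intervals (Caret ss) a w =
      subdivide (leaf_intervals t a w) (replicate (num_leaves t) (Caret (replicate m Leaf))))"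
  using assms(3)
proof (induction t)
  case Leaf
  show ?case by (rule exI[of _ "replicate m Leaf"]) auto
next
  case (Caret ts)
  let ?c = "Caret (replicate m Leaf)" and ?p = "length ts"
  have p: "?p > 0" "?p \<in> N" and m: "m > 0" using Caret.prems assms by auto
  have "\<forall>t\<in>set ts. \<exists>ss. length ss = m \<and> (\<forall>s\<in>set ss. nary_tree N s) \<and>
    (\<forall>a w. leaf_intervals (Caret ss) a w =
      subdivide (leaf_intervals t a w) (replicate (num_leaves t) ?c))"
    using Caret by auto
  then obtain R where R: "\<And>t. t \<in> set ts \<Longrightarrow> length (R t) = m"
    "\<And>t s. t \<in> set ts \<Longrightarrow> s \<in> set (R t) \<Longrightarrow> nary_tree N s"
    "\<And>t a w. t \<in> set ts \<Longrightarrow> leaf_intervals (Caret (R t)) a w =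
      subdivide (leaf_intervals t a w) (replicate (num_leaves t) ?c)"
    by metis
  \<comment> \<open>By induction each of the \<open>?p\<close> children is a root caret over
    \<open>m\<close> trees. The resulting row of \<open>m * ?p\<close> trees is regrouped into
    \<open>m\<close> blocks of \<open>?p\<close>.\<close>
  have "length (concat (map R ts)) = m * ?p"
    using R(1) by (simp add: length_concat o_def sum_list_triv cong: map_cong)
  then obtain yss where yss: "length yss = m" "\<forall>ys\<in>set yss. length ys = ?p"
    "concat yss = concat (map R ts)"
    using list_into_chunks by blast
  have cc: "concat (map (\<lambda>t. replicate (num_leaves t) ?c) ts) =
      replicate (sum_list (map num_leaves ts)) ?c"
    by (induction ts) (auto simp: replicate_add)
  have "leaf_intervals (Caret (map Caret yss)) a w =
      subdivide (leaf_intervals (Caret ts) a w) (replicate (num_leaves (Caret ts)) ?c)" for a w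
  proof -
    \<comment> \<open>Both groupings flatten to the same row, and the widths agree because dividing
      by \<open>m\<close> and by \<open>?p\<close> commutes.\<close>
    have "leaf_intervals (Caret (map Caret yss)) a w =
        leaf_intervals_list (concat (map R ts)) a (w / m / ?p)"
      using leaf_intervals_list_carets[OF yss(2) p(1)] yss by simp
    also have "\<dots> = leaf_intervals_list (map Caret (map R ts)) a (w / ?p)"
      using leaf_intervals_list_carets[of "map R ts" m a "w / ?p"] R(1) m
      by (simp add: mult.commute)
    also have "\<dots> = subdivide (leaf_intervals_list ts a (w / ?p))
        (concat (map (\<lambda>t. replicate (num_leaves t) ?c) ts))"
      by (rule leaf_intervals_list_concat_subdivide) (use R(3) in auto)
    finally show ?thesis using cc by simp
  qed
  moreover have "\<forall>s\<in>set (map Caret yss). nary_tree N s"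
  proof -
    have "set (concat yss) = set (concat (map R ts))" using yss(3) by simp
    then have "\<forall>ys\<in>set yss. \<forall>s\<in>set ys. \<exists>t\<in>set ts. s \<in> set (R t)" by auto
    then show ?thesis using yss(2) p R(2) by fastforce
  qed
  ultimately show ?case using yss(1) by (intro exI[of _ "map Caret yss"]) auto
qed

lemma sum_list_map_concat:
  fixes f :: "'a \<Rightarrow> nat"
  shows "sum_list (concat (map (\<lambda>i. map f (U i)) xs)) = (\<Sum>i\<leftarrow>xs. \<Sum>u\<leftarrow>U i. f u)"
  by (induction xs) auto

lemma sum_list_map_mult_le:
  fixes xs ys :: "nat list" and C :: nat
  assumes "length xs = length ys" "\<And>i. i < length xs \<Longrightarrow> xs ! i \<le> C * ys ! i"
  shows "sum_list xs \<le> C * sum_list ys"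
  using assms
proof (induction xs ys rule: list_induct2)
  case (Cons x xs y ys)
  have "x \<le> C * y" using Cons.prems[of 0] by simp
  moreover have "sum_list xs \<le> C * sum_list ys"
    using Cons.prems[of "Suc i" for i] by (intro Cons.IH) auto
  ultimately show ?case by (simp add: distrib_left)
qed auto

text \<open>The order of the quantifiers matters: \<open>C\<close> depends on \<open>t\<close> only,
  so refining by a fixed tree costs a constant factor whatever \<open>s\<close> is. The trees
  \<open>us\<close> are hung on \<open>s\<close> and the trees \<open>vs\<close> on
  \<open>t\<close>.\<close>

lemma common_refinement:
  assumes "\<forall>q\<in>N. q > 0" "nary_tree N t"
  shows "\<exists>C. \<forall>s. nary_tree N s \<longrightarrow> (\<exists>us vs. length us = num_leaves s \<and> length vs = num_leaves t \<and>
    (\<forall>u\<in>set us \<union> set vs. nary_tree N u) \<and>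
    (\<forall>a w. subdivide (leaf_intervals s a w) us = subdivide (leaf_intervals t a w) vs) \<and>
    sum_list (map num_leaves us) \<le> C * num_leaves s)"
  using assms(2)
proof (induction t)
  case Leaf
  \<comment> \<open>Over a single leaf, \<open>s\<close> itself is the common refinement: nothing is
    added to \<open>s\<close>, and \<open>s\<close> is hung on the leaf, so the constant is
    1.\<close>
  have "\<exists>us vs. length us = num_leaves s \<and> length vs = num_leaves Leaf \<and>
      (\<forall>u\<in>set us \<union> set vs. nary_tree N u) \<and>
      (\<forall>a w. subdivide (leaf_intervals s a w) us = subdivide (leaf_intervals Leaf a w) vs) \<and>
      sum_list (map num_leaves us) \<le> 1 * num_leaves s" if "nary_tree N s" for s
  proof -
    have "subdivide Is (replicate (length Is) Leaf) = Is" for Is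
      by (induction Is) auto
    from this[of "leaf_intervals s a w" for a w]
    have "subdivide (leaf_intervals s a w) (replicate (num_leaves s) Leaf) = leaf_intervals s a w"
      for a w by simp
    then show ?thesis
      using that
      by (intro exI[of _ "replicate (num_leaves s) Leaf"] exI[of _ "[s]"]) (auto simp: sum_list_replicate)
  qed
  then show ?case by blast
next
  case (Caret ts)
  let ?m = "length ts" and ?c = "Caret (replicate (length ts) Leaf)"
  have m: "?m \<in> N" "?m > 0" using Caret.prems assms by auto
  have "\<forall>t\<in>set ts. \<exists>C. \<forall>s. nary_tree N s \<longrightarrow> (\<exists>us vs. length us = num_leaves s \<and>
    length vs = num_leaves t \<and> (\<forall>u\<in>set us \<union> set vs. nary_tree N u) \<and>
    (\<forall>a w. subdivide (leaf_intervals s a w) us = subdivide (leaf_intervals t a w) vs) \<and>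
    sum_list (map num_leaves us) \<le> C * num_leaves s)"
    using Caret by auto
  then obtain C where C: "\<And>t s. t \<in> set ts \<Longrightarrow> nary_tree N s \<Longrightarrow>
    \<exists>us vs. length us = num_leaves s \<and>
    length vs = num_leaves t \<and> (\<forall>u\<in>set us \<union> set vs. nary_tree N u) \<and>
    (\<forall>a w. subdivide (leaf_intervals s a w) us = subdivide (leaf_intervals t a w) vs) \<and>
    sum_list (map num_leaves us) \<le> C t * num_leaves s"
    by metis
  \<comment> \<open>The worst constant among the subtrees. The further factor \<open>?m\<close> in
    the bound pays for the carets put on all leaves of \<open>s\<close>.\<close>
  define D where "D = Max (C ` set ts)"
  have "\<exists>us vs. length us = num_leaves s \<and> length vs = num_leaves (Caret ts) \<and>
    (\<forall>u\<in>set us \<union> set vs. nary_tree N u) \<and>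
    (\<forall>a w. subdivide (leaf_intervals s a w) us = subdivide (leaf_intervals (Caret ts) a w) vs) \<and>
    sum_list (map num_leaves us) \<le> (D * ?m) * num_leaves s" if s: "nary_tree N s" for s
  proof -
    let ?cs = "replicate (num_leaves s) ?c"
    obtain ss where ss: "length ss = ?m" "\<forall>r\<in>set ss. nary_tree N r"
      "\<And>a w. leaf_intervals (Caret ss) a w = subdivide (leaf_intervals s a w) ?cs"
      using carets_at_leaves_to_root[OF m(1) assms(1) s] by blast
    \<comment> \<open>The trees \<open>ss\<close> are known only through their leaf intervals, so
      their leaves are counted as intervals.\<close>
    have L: "sum_list (map num_leaves ss) = ?m * num_leaves s"
      using arg_cong[OF ss(3)[of 0 1], of length]
      by (simp add: length_subdivide sum_list_replicate)
    have "\<forall>i. i < ?m \<longrightarrow> (\<exists>us vs. length us = num_leaves (ss ! i) \<and>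
      length vs = num_leaves (ts ! i) \<and> (\<forall>u\<in>set us \<union> set vs. nary_tree N u) \<and>
      (\<forall>a w. subdivide (leaf_intervals (ss ! i) a w) us =
             subdivide (leaf_intervals (ts ! i) a w) vs) \<and>
      sum_list (map num_leaves us) \<le> C (ts ! i) * num_leaves (ss ! i))"
      using C ss by simp
    then obtain U V where UV: "\<And>i. i < ?m \<Longrightarrow> length (U i) = num_leaves (ss ! i)"
      "\<And>i. i < ?m \<Longrightarrow> length (V i) = num_leaves (ts ! i)"
      "\<And>i u. i < ?m \<Longrightarrow> u \<in> set (U i) \<union> set (V i) \<Longrightarrow> nary_tree N u"
      "\<And>i a w. i < ?m \<Longrightarrow> subdivide (leaf_intervals (ss ! i) a w) (U i) =
             subdivide (leaf_intervals (ts ! i) a w) (V i)"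
      "\<And>i. i < ?m \<Longrightarrow> sum_list (map num_leaves (U i)) \<le> C (ts ! i) * num_leaves (ss ! i)"
      by metis
    let ?U = "map U [0..<?m]" and ?V = "map V [0..<?m]"
    \<comment> \<open>The trees \<open>?g\<close> link the two sides: by the choice of
      \<open>U\<close> and \<open>V\<close> their intervals refine both the row \<open>ss\<close>
      and the row \<open>ts\<close>.\<close>
    let ?g = "map (\<lambda>i. graft (ss ! i) (U i)) [0..<?m]"
    have lU: "length (concat ?U) = sum_list (map num_leaves ss)"
    proof -
      have "map length ?U = map num_leaves ss"
        using UV(1) ss(1) by (intro nth_equalityI) auto
      then show ?thesis by (simp add: length_concat)
    qed
    have lV: "length (concat ?V) = sum_list (map num_leaves ts)"
    proof -
      have "map length ?V = map num_leaves ts"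
        using UV(2) by (intro nth_equalityI) auto
      then show ?thesis by (simp add: length_concat)
    qed
    have lg: "length (concat ?U) = sum_list (map num_leaves ?cs)"
      using lU L by (simp add: sum_list_replicate)
    have "leaf_intervals_list ?g a w = subdivide (leaf_intervals_list ss a w) (concat ?U)" for a w
      by (rule leaf_intervals_list_concat_subdivide)
        (use UV ss in \<open>auto simp: leaf_intervals_graft\<close>)
    moreover have "leaf_intervals_list ?g a w =
        subdivide (leaf_intervals_list ts a w) (concat ?V)" for a w
      by (rule leaf_intervals_list_concat_subdivide)
        (use UV ss in \<open>auto simp: leaf_intervals_graft\<close>)
    ultimately have eq: "subdivide (leaf_intervals (Caret ss) a w) (concat ?U) =
        subdivide (leaf_intervals (Caret ts) a w) (concat ?V)" for a w
      using ss(1) by simp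
    \<comment> \<open>The trees \<open>U\<close> hang on the leaves of \<open>ss\<close>, that is,
      on the carets \<open>?cs\<close>. Grafting them onto these carets turns them into trees on the
      leaves of \<open>s\<close>.\<close>
    have eq': "subdivide (leaf_intervals s a w) (graft_list ?cs (concat ?U)) =
        subdivide (leaf_intervals (Caret ts) a w) (concat ?V)" for a w
      using subdivide_subdivide[OF _ lg, of "leaf_intervals s a w"] eq[of a w] ss(3)[of a w]
      by simp
    have nary: "\<forall>u\<in>set (graft_list ?cs (concat ?U)). nary_tree N u"
      by (rule nary_graft_list) (use lg UV(3) m in auto)
    have "sum_list (map num_leaves (graft_list ?cs (concat ?U))) =
        length (subdivide (leaf_intervals s 0 1) (graft_list ?cs (concat ?U)))"
      by (simp add: length_subdivide)
    also have "\<dots> = length (subdivide (leaf_intervals (Caret ss) 0 1) (concat ?U))"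
      by (simp only: eq eq')
    also have "\<dots> = sum_list (map num_leaves (concat ?U))"
      using lU by (intro length_subdivide) simp
    also have "\<dots> = sum_list (map (\<lambda>i. sum_list (map num_leaves (U i))) [0..<?m])"
      by (simp add: map_concat o_def sum_list_map_concat)
    also have "\<dots> \<le> D * sum_list (map num_leaves ss)"
    proof (rule sum_list_map_mult_le)
      fix i assume "i < length (map (\<lambda>i. sum_list (map num_leaves (U i))) [0..<?m])"
      then have i: "i < ?m" by simp
      have "C (ts ! i) \<le> D" unfolding D_def using i by (intro Max_ge) auto
      then have "C (ts ! i) * num_leaves (ss ! i) \<le> D * num_leaves (ss ! i)"
        by (rule mult_right_mono) simp
      then show "map (\<lambda>i. sum_list (map num_leaves (U i))) [0..<?m] ! i
          \<le> D * map num_leaves ss ! i"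
        using order_trans[OF UV(5)[OF i]] i ss(1) by simp
    qed (use ss in simp)
    also have "\<dots> = (D * ?m) * num_leaves s" using L by simp
    finally have le: "sum_list (map num_leaves (graft_list ?cs (concat ?U)))
        \<le> (D * ?m) * num_leaves s" .
    show ?thesis
      using lV eq' nary le UV(3)
      by (intro exI[of _ "graft_list ?cs (concat ?U)"] exI[of _ "concat ?V"]) auto
  qed
  then show ?case by blast
qed


section \<open>Piecewise affine maps between partitions\<close>

text \<open>The common parameter \<open>t\<close> makes composition of such maps immediate and
  avoids dividing by the width of \<open>I\<close>.\<close>

definition affine_onto :: "(real \<Rightarrow> real) \<Rightarrow> real \<times> real \<Rightarrow> real \<times> real \<Rightarrow> bool" where
  "affine_onto f I J \<longleftrightarrow>
     (\<forall>t\<in>{0..1}. f (fst I + t * (snd I - fst I)) = fst J + t * (snd J - fst J))"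

text \<open>For \<open>0 \<le> r \<le> m + 1\<close> the point \<open>a + r * w\<close> goes to
  \<open>c + r * v\<close>; the claims are the ranges from 0 to 1 and from 1 to
  \<open>m + 1\<close>. Splitting off one cell follows the recursion of
  \<open>leaf_intervals_list\<close>, with \<open>m\<close> the number of remaining cells.\<close>

lemma affine_onto_split:
  assumes "affine_onto f (a, a + (m + 1) * w) (c, c + (m + 1) * v)" "m \<ge> (0::real)"
  shows "affine_onto f (a, a + w) (c, c + v)"
    and "affine_onto f (a + w, a + w + m * w) (c + v, c + v + m * v)"
proof -
  have *: "f (a + (p * (m + 1)) * w) = c + (p * (m + 1)) * v" if "p \<in> {0..1}" for p
    using assms that by (auto simp: affine_onto_def mult.assoc)
  have r: "f (a + r * w) = c + r * v" if "0 \<le> r" "r \<le> m + 1" for r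
  proof -
    have "r / (m + 1) * (m + 1) = r" "r / (m + 1) \<in> {0..1}" using that assms(2) by auto
    then show ?thesis using *[of "r / (m + 1)"] by simp
  qed
  show "affine_onto f (a, a + w) (c, c + v)"
    using assms(2) by (auto simp: affine_onto_def intro!: r)
  show "affine_onto f (a + w, a + w + m * w) (c + v, c + v + m * v)"
    unfolding affine_onto_def
  proof
    fix t :: real assume t: "t \<in> {0..1}"
    have "t * m \<le> 1 * m" by (rule mult_right_mono) (use t assms in auto)
    then have "f (a + (1 + t * m) * w) = c + (1 + t * m) * v"
      using t assms by (intro r) auto
    then show "f (fst (a + w, a + w + m * w) +
        t * (snd (a + w, a + w + m * w) - fst (a + w, a + w + m * w))) =
      fst (c + v, c + v + m * v) + t * (snd (c + v, c + v + m * v) - fst (c + v, c + v + m * v))"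
      by (simp add: algebra_simps)
  qed
qed

text \<open>Affine maps carry equal parts to equal parts. Hence hanging the same trees on
  corresponding leaves of a diagram does not change the map.\<close>

lemma affine_onto_leaf_intervals:
  "affine_onto f (a, a + w) (c, c + v) \<Longrightarrow>
    list_all2 (affine_onto f) (leaf_intervals t a w) (leaf_intervals t c v)"
  and affine_onto_leaf_intervals_list:
  "affine_onto f (a, a + real (length ts) * w) (c, c + real (length ts) * v) \<Longrightarrow>
    list_all2 (affine_onto f) (leaf_intervals_list ts a w) (leaf_intervals_list ts c v)"
proof (induction t a w and ts a w arbitrary: c v and c v
    rule: leaf_intervals_leaf_intervals_list.induct)
  case (2 ts a w)
  show ?case
  proof (cases ts)
    case (Cons t us)
    then show ?thesis using 2 by simp
  qed simp
next
  case (4 t ts a w)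
  have "affine_onto f (a, a + (real (length ts) + 1) * w) (c, c + (real (length ts) + 1) * v)"
    using 4(3) by (simp add: add.commute)
  note s = affine_onto_split[OF this]
  show ?case
    using 4(1)[OF s(1)] 4(2)[OF s(2)] by (auto intro: list_all2_appendI)
qed auto

lemma affine_onto_subdivide:
  "list_all2 (affine_onto f) Is Js \<Longrightarrow>
    list_all2 (affine_onto f) (subdivide Is us) (subdivide Js us)"
proof (induction arbitrary: us rule: list_all2_induct)
  case (Cons I Is J Js)
  show ?case
  proof (cases us)
    case (Cons u vs)
    have "list_all2 (affine_onto f) (leaf_intervals u (fst I) (snd I - fst I))
        (leaf_intervals u (fst J) (snd J - fst J))"
      using Cons.hyps by (intro affine_onto_leaf_intervals) simp
    then show ?thesis using Cons.IH[of vs] Cons by (auto intro: list_all2_appendI)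
  qed simp
qed simp

fun partitions :: "real \<Rightarrow> (real \<times> real) list \<Rightarrow> real \<Rightarrow> bool" where
  "partitions a [] b \<longleftrightarrow> a = b"
| "partitions a (I # Is) b \<longleftrightarrow> fst I = a \<and> a < snd I \<and> partitions (snd I) Is b"

lemma partitions_append:
  "partitions a Is b \<Longrightarrow> partitions b Js c \<Longrightarrow> partitions a (Is @ Js) c"
  by (induction Is arbitrary: a) auto

lemma partitions_leaf_intervals:
  "nary_tree N t \<Longrightarrow> \<forall>q\<in>N. q > 0 \<Longrightarrow> w > 0 \<Longrightarrow> partitions a (leaf_intervals t a w) (a + w)"
  and partitions_leaf_intervals_list:
  "\<forall>t\<in>set ts. nary_tree N t \<Longrightarrow> \<forall>q\<in>N. q > 0 \<Longrightarrow> w > 0 \<Longrightarrow>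
    partitions a (leaf_intervals_list ts a w) (a + real (length ts) * w)"
proof (induction t a w and ts a w rule: leaf_intervals_leaf_intervals_list.induct)
  case (2 ts a w)
  \<comment> \<open>A caret without children would leave its interval uncovered; positive arities
    exclude it.\<close>
  have len: "length ts > 0" using 2(2,3) by auto
  have "partitions a (leaf_intervals_list ts a (w / real (length ts)))
      (a + real (length ts) * (w / real (length ts)))"
    by (rule 2(1)) (use 2(2-) len in auto)
  then show ?case using len by simp
next
  case (4 t ts a w)
  have "partitions a (leaf_intervals t a w) (a + w)"
    by (rule 4(1)) (use 4(3-) in auto)
  moreover have "partitions (a + w) (leaf_intervals_list ts (a + w) w)
      (a + w + real (length ts) * w)"
    by (rule 4(2)) (use 4(3-) in auto)
  ultimately have "partitions a (leaf_intervals t a w @ leaf_intervals_list ts (a + w) w)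
      (a + w + real (length ts) * w)"
    by (rule partitions_append)
  then show ?case by (simp add: distrib_right add.assoc)
qed auto

lemma partitions_le: "partitions a Is b \<Longrightarrow> a \<le> b"
  by (induction Is arbitrary: a) force+

lemma partitions_bounds:
  "partitions a Is b \<Longrightarrow> I \<in> set Is \<Longrightarrow> a \<le> fst I \<and> fst I < snd I \<and> snd I \<le> b"
proof (induction Is arbitrary: a)
  case (Cons K Is)
  have "snd K \<le> b" using Cons.prems partitions_le by auto
  then show ?case using Cons by fastforce
qed simp

text \<open>Right endpoints suffice as breakpoints, since every left endpoint other than
  \<open>a\<close> is the right endpoint of the preceding interval.\<close>

lemma partitions_interval_containing:
  "partitions a Is b \<Longrightarrow> a \<le> p \<Longrightarrow> p < q \<Longrightarrow> q \<le> b \<Longrightarrow> {p<..<q} \<inter> snd ` set Is = {} \<Longrightarrow>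
    \<exists>i<length Is. fst (Is ! i) \<le> p \<and> q \<le> snd (Is ! i)"
proof (induction Is arbitrary: a)
  case (Cons I Is)
  show ?case
  proof (cases "q \<le> snd I")
    case True
    then show ?thesis using Cons.prems by (intro exI[of _ 0]) auto
  next
    case False
    then have "snd I \<le> p" using Cons.prems by fastforce
    then obtain i where "i < length Is" "fst (Is ! i) \<le> p \<and> q \<le> snd (Is ! i)"
      using Cons.IH[of "snd I"] Cons.prems by auto
    then show ?thesis by (intro exI[of _ "Suc i"]) auto
  qed
qed simp

lemma partitions_point_containing:
  "partitions a Is b \<Longrightarrow> a < b \<Longrightarrow> p \<in> {a..b} \<Longrightarrow>
    \<exists>i<length Is. p \<in> {fst (Is ! i)..snd (Is ! i)}"
proof (induction Is arbitrary: a)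
  case (Cons I Is)
  show ?case
  proof (cases "p \<le> snd I")
    case True
    then show ?thesis using Cons.prems by (intro exI[of _ 0]) auto
  next
    case False
    then obtain i where "i < length Is" "p \<in> {fst (Is ! i)..snd (Is ! i)}"
      using Cons.IH[of "snd I"] Cons.prems by auto
    then show ?thesis by (intro exI[of _ "Suc i"]) auto
  qed
qed simp

lemma affine_onto_eval:
  assumes "affine_onto f I J" "fst I < snd I" "p \<in> {fst I..snd I}"
  shows "f p = (snd J - fst J) / (snd I - fst I) * (p - fst I) + fst J"
proof -
  define t where "t = (p - fst I) / (snd I - fst I)"
  have "t \<in> {0..1}" using assms by (auto simp: t_def)
  moreover have "fst I + t * (snd I - fst I) = p" using assms(2) by (simp add: t_def)
  ultimately have "f p = fst J + t * (snd J - fst J)"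
    using assms(1) by (metis affine_onto_def)
  then show ?thesis by (simp add: t_def)
qed

text \<open>The assumption \<open>f a = c\<close> carries the gluing: the first piece ends with
  \<open>f (snd I) = snd J\<close>, which is the same assumption for the remaining pieces.\<close>

lemma piecewise_affine_strict_mono_continuous:
  assumes "list_all2 (affine_onto f) Is Js" "partitions a Is b" "partitions c Js d" "f a = c"
  shows "f b = d \<and> strict_mono_on {a..b} f \<and> continuous_on {a..b} f"
  using assms
proof (induction arbitrary: a c rule: list_all2_induct)
  case Nil
  then show ?case by (auto simp: strict_mono_on_def)
next
  case (Cons I Is J Js)
  define s where "s = (snd J - fst J) / (snd I - fst I)"
  have I: "fst I = a" "a < snd I" "fst J = c" "c < snd J" using Cons.prems by auto
  have s: "s > 0" using I by (simp add: s_def)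
  have f: "f p = s * (p - a) + c" if "p \<in> {a..snd I}" for p
    using affine_onto_eval[OF Cons.hyps(1), of p] that I by (simp add: s_def)
  have fI: "f (snd I) = snd J" using f[of "snd I"] I by (simp add: s_def)
  have IH: "f b = d" "strict_mono_on {snd I..b} f" "continuous_on {snd I..b} f"
    using Cons.IH[of "snd I" "snd J"] Cons.prems fI by auto
  have le: "snd I \<le> b" using Cons.prems partitions_le by auto
  have mono1: "f p < f q" if "p \<in> {a..snd I}" "q \<in> {a..snd I}" "p < q" for p q
    using f[OF that(1)] f[OF that(2)] s that(3) by simp
  have mono2: "f p < f q" if "p \<in> {snd I..b}" "q \<in> {snd I..b}" "p < q" for p q
    using IH(2) that by (auto simp: strict_mono_on_def)
  have "strict_mono_on {a..b} f"
  proof (rule strict_mono_onI)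
    fix p q assume pq: "p \<in> {a..b}" "q \<in> {a..b}" "p < q"
    consider "q \<le> snd I" | "snd I \<le> p" | "p < snd I" "snd I < q" by linarith
    then show "f p < f q"
    proof cases
      case 3
      have "f p < f (snd I)" by (rule mono1) (use 3 pq I in auto)
      also have "\<dots> < f q" by (rule mono2) (use 3 pq le in auto)
      finally show ?thesis .
    qed (use pq mono1 mono2 in auto)
  qed
  moreover have "continuous_on {a..b} f"
  proof -
    have "continuous_on {a..snd I} (\<lambda>p. s * (p - a) + c)" by (intro continuous_intros)
    then have "continuous_on {a..snd I} f"
      by (rule continuous_on_eq) (simp add: f)
    then have "continuous_on ({a..snd I} \<union> {snd I..b}) f"
      by (intro continuous_on_closed_Un IH(3)) auto
    moreover have "{a..snd I} \<union> {snd I..b} = {a..b}" using I le by auto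
    ultimately show ?thesis by simp
  qed
  ultimately show ?case using IH(1) by simp
qed

lemma ex_piecewise_affine:
  assumes "length Is = length Js" "partitions a Is b" "partitions c Js d"
  shows "\<exists>f. list_all2 (affine_onto f) Is Js \<and> f a = c"
  using assms
proof (induction Is Js arbitrary: a c rule: list_induct2)
  case (Cons I Is J Js)
  have I: "fst I = a" "a < snd I" "fst J = c" using Cons.prems by auto
  obtain f where f: "list_all2 (affine_onto f) Is Js" "f (snd I) = snd J"
    using Cons.IH[of "snd I" "snd J"] Cons.prems by auto
  \<comment> \<open>At the junction \<open>snd I\<close> both branches have the value
    \<open>snd J\<close>, because \<open>f\<close> was chosen with \<open>f (snd I) = snd J\<close>.
    So \<open>h\<close> agrees with \<open>f\<close> on all later intervals, endpoints
    included.\<close>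
  define h where
    "h p = (if p \<le> snd I then c + (p - a) / (snd I - a) * (snd J - c) else f p)" for p
  have "affine_onto h I J"
    unfolding affine_onto_def
  proof
    fix t :: real assume t: "t \<in> {0..1}"
    have "t * (snd I - a) \<le> 1 * (snd I - a)" by (rule mult_right_mono) (use t I in auto)
    then have "a + t * (snd I - a) \<le> snd I" by simp
    then show "h (fst I + t * (snd I - fst I)) = fst J + t * (snd J - fst J)"
      using I by (simp add: h_def)
  qed
  moreover have "list_all2 (affine_onto h) Is Js"
  proof (rule list.rel_mono_strong[OF f(1)])
    fix K L assume K: "K \<in> set Is" and a: "affine_onto f K L"
    have K': "snd I \<le> fst K" "fst K < snd K"
      using partitions_bounds[of "snd I" Is b K] K Cons.prems by auto
    moreover have "h p = f p" if "p \<ge> snd I" for p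
      using that f(2) I by (cases "p = snd I") (auto simp: h_def)
    moreover have "fst K + t * (snd K - fst K) \<ge> snd I" if "t \<in> {0..1}" for t
    proof -
      have "0 \<le> t * (snd K - fst K)" using that K' by simp
      then show ?thesis using K' by linarith
    qed
    ultimately show "affine_onto h K L" using a unfolding affine_onto_def by metis
  qed
  moreover have "h a = c" using I by (simp add: h_def)
  ultimately show ?case by auto
qed auto


section \<open>Diagrams and group elements\<close>

lemma slope_group_divide:
  assumes "\<forall>j\<in>{1..k}. n j \<ge> 2" "x \<in> slope_group k n" "y \<in> slope_group k n"
  shows "x / y \<in> slope_group k n"
proof -
  obtain e e' where "x = (\<Prod>j=1..k. real (n j) powi e j)" "y = (\<Prod>j=1..k. real (n j) powi e' j)"
    using assms by (auto simp: slope_group_def)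
  then have "x / y = (\<Prod>j=1..k. real (n j) powi e j / real (n j) powi e' j)"
    by (simp add: prod_dividef)
  also have "\<dots> = (\<Prod>j=1..k. real (n j) powi (e j - e' j))"
  proof (intro prod.cong refl)
    fix j assume "j \<in> {1..k}"
    then have "real (n j) \<noteq> 0" using assms(1) by fastforce
    then show "real (n j) powi e j / real (n j) powi e' j = real (n j) powi (e j - e' j)"
      by (simp add: power_int_diff)
  qed
  finally show ?thesis by (auto simp: slope_group_def intro!: exI[of _ "\<lambda>j. e j - e' j"])
qed

lemma one_in_slope_group: "1 \<in> slope_group k n"
  by (auto simp: slope_group_def intro!: exI[of _ "\<lambda>_. 0"])

lemma arity_in_slope_group:
  assumes "i \<in> {1..k}"
  shows "real (n i) \<in> slope_group k n"
proof -
  have "(\<Prod>j=1..k. real (n j) powi (if j = i then 1 else 0)) =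
      (\<Prod>j=1..k. if j = i then real (n j) else 1)"
    by (intro prod.cong) auto
  also have "\<dots> = real (n i)" using assms by (simp add: prod.delta)
  finally show ?thesis
    unfolding slope_group_def by (intro CollectI exI[of _ "\<lambda>j. if j = i then 1 else 0"]) simp
qed

lemma localized_ints_add:
  assumes "N > 0" "x \<in> localized_ints N" "y \<in> localized_ints N"
  shows "x + y \<in> localized_ints N"
proof -
  obtain p e q f where "x = of_int p / real N ^ e" "y = of_int q / real N ^ f"
    using assms by (auto simp: localized_ints_def)
  then have "x + y = of_int (p * int N ^ f + q * int N ^ e) / real N ^ (e + f)"
    using assms(1) by (simp add: add_frac_eq power_add mult.commute)
  then show ?thesis unfolding localized_ints_def by blast
qed

lemma localized_ints_divide:
  assumes "N > 0" "x \<in> localized_ints N" "m dvd N"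
  shows "x / real m \<in> localized_ints N"
proof -
  obtain p e where x: "x = of_int p / real N ^ e"
    using assms by (auto simp: localized_ints_def)
  obtain l where N: "N = m * l" using assms(3) by auto
  have "m > 0" "l > 0" using assms(1) N by auto
  then have "x / real m = of_int (p * int l) / real N ^ Suc e"
    using x by (simp add: N field_simps)
  then show ?thesis unfolding localized_ints_def by blast
qed

lemma int_in_localized_ints: "of_int p \<in> localized_ints N"
  unfolding localized_ints_def by (intro CollectI exI[of _ p] exI[of _ 0]) simp

text \<open>Widths arise from the root width by dividing by arities along a path. The slopes of a
  represented map are quotients of two such widths.\<close>

lemma leaf_interval_width:
  "nary_tree (n ` {1..k}) t \<Longrightarrow> \<forall>j\<in>{1..k}. n j \<ge> 2 \<Longrightarrow> w \<in> slope_group k n \<Longrightarrow>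
    \<forall>I\<in>set (leaf_intervals t a w). snd I - fst I \<in> slope_group k n"
  and "\<forall>t\<in>set ts. nary_tree (n ` {1..k}) t \<Longrightarrow> \<forall>j\<in>{1..k}. n j \<ge> 2 \<Longrightarrow> w \<in> slope_group k n \<Longrightarrow>
    \<forall>I\<in>set (leaf_intervals_list ts a w). snd I - fst I \<in> slope_group k n"
proof (induction t a w and ts a w rule: leaf_intervals_leaf_intervals_list.induct)
  case (2 ts a w)
  then obtain j where "j \<in> {1..k}" "length ts = n j" by auto
  then have "w / real (length ts) \<in> slope_group k n"
    using 2(3,4) by (simp add: slope_group_divide arity_in_slope_group)
  then show ?case using 2(1-3) by simp
qed auto

lemma leaf_interval_endpoint:
  fixes k :: nat and n :: "nat \<Rightarrow> nat"
  defines "L \<equiv> localized_ints (\<Prod>j=1..k. n j)"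
  assumes "\<forall>j\<in>{1..k}. n j \<ge> 2"
  shows "nary_tree (n ` {1..k}) t \<Longrightarrow> a \<in> L \<Longrightarrow> w \<in> L \<Longrightarrow>
      \<forall>I\<in>set (leaf_intervals t a w). snd I \<in> L"
    and "\<forall>t\<in>set ts. nary_tree (n ` {1..k}) t \<Longrightarrow> a \<in> L \<Longrightarrow> w \<in> L \<Longrightarrow>
      \<forall>I\<in>set (leaf_intervals_list ts a w). snd I \<in> L"
proof -
  have pos: "(\<Prod>j=1..k. n j) > 0" by (rule prod_pos) (use assms(2) in force)
  have add: "x + y \<in> L" if "x \<in> L" "y \<in> L" for x y
    using localized_ints_add[OF pos] that by (simp add: L_def)
  have divide: "x / real m \<in> L" if x: "x \<in> L" and m: "m \<in> n ` {1..k}" for x m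
  proof -
    obtain j where "j \<in> {1..k}" "m = n j" using m by blast
    then have "m dvd (\<Prod>j=1..k. n j)" using dvd_prodI[of "{1..k}" j n] by simp
    then show ?thesis using localized_ints_divide[OF pos x[unfolded L_def]] by (simp only: L_def)
  qed
  show "nary_tree (n ` {1..k}) t \<Longrightarrow> a \<in> L \<Longrightarrow> w \<in> L \<Longrightarrow>
      \<forall>I\<in>set (leaf_intervals t a w). snd I \<in> L"
    and "\<forall>t\<in>set ts. nary_tree (n ` {1..k}) t \<Longrightarrow> a \<in> L \<Longrightarrow> w \<in> L \<Longrightarrow>
      \<forall>I\<in>set (leaf_intervals_list ts a w). snd I \<in> L"
  proof (induction t a w and ts a w rule: leaf_intervals_leaf_intervals_list.induct)
    case (1 a w)
    then show ?case by (simp add: add)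
  next
    case (2 ts a w)
    have "\<forall>I\<in>set (leaf_intervals_list ts a (w / real (length ts))). snd I \<in> L"
      by (rule 2(1)) (use 2(2-) divide in simp_all)
    then show ?case by simp
  next
    case (3 a w)
    show ?case by simp
  next
    case (4 t ts a w)
    have "\<forall>I\<in>set (leaf_intervals t a w). snd I \<in> L"
      by (rule 4(1)) (use 4(3-) in simp_all)
    moreover have "\<forall>I\<in>set (leaf_intervals_list ts (a + w) w). snd I \<in> L"
      by (rule 4(2)) (use 4(3-) add in simp_all)
    ultimately show ?case by auto
  qed
qed

section \<open>Maps represented by tree-pair diagrams\<close>

lemma represents_iff_list_all2:
  assumes "num_leaves T = num_leaves S"
  shows "represents T S f \<longleftrightarrow> f \<in> extensional {0..1} \<and>
    list_all2 (affine_onto f) (leaf_intervals T 0 1) (leaf_intervals S 0 1)"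
  unfolding represents_def affine_onto_def list_all2_conv_all_nth using assms
  by (simp add: case_prod_unfold Let_def)

lemma partitions_unit_leaf_intervals:
  assumes "nary_tree (n ` {1..k}) T" "\<forall>j\<in>{1..k}. n j \<ge> 2"
  shows "partitions 0 (leaf_intervals T 0 1) 1"
proof -
  have "\<forall>q\<in>n ` {1..k}. q > 0" using assms(2) by force
  then show ?thesis using partitions_leaf_intervals[OF assms(1), of 1 0] by simp
qed

lemma affine_onto_unique:
  assumes "list_all2 (affine_onto f) Is Js" "list_all2 (affine_onto g) Is Js"
    and "partitions a Is b" "a < b" "p \<in> {a..b}"
  shows "f p = g p"
proof -
  obtain i where i: "i < length Is" "p \<in> {fst (Is ! i)..snd (Is ! i)}"
    using partitions_point_containing assms by blast
  have "fst (Is ! i) < snd (Is ! i)" using partitions_bounds[OF assms(3)] i by auto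
  moreover have "affine_onto f (Is ! i) (Js ! i)" "affine_onto g (Is ! i) (Js ! i)"
    using assms i by (auto simp: list_all2_conv_all_nth)
  ultimately show ?thesis using affine_onto_eval i(2) by metis
qed

text \<open>Needed for the definite description in \<open>string_to\<close> and for recognising the
  identity among composites.\<close>

lemma represents_unique:
  assumes "tree_pair k n T S" "\<forall>j\<in>{1..k}. n j \<ge> 2" "represents T S f" "represents T S g"
  shows "f = g"
proof (rule extensionalityI)
  show "f \<in> extensional {0..1}" "g \<in> extensional {0..1}"
    using assms by (auto simp: represents_def)
  have T: "nary_tree (n ` {1..k}) T" "num_leaves T = num_leaves S"
    using assms(1) by (auto simp: tree_pair_def)
  have fg: "list_all2 (affine_onto f) (leaf_intervals T 0 1) (leaf_intervals S 0 1)"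
    "list_all2 (affine_onto g) (leaf_intervals T 0 1) (leaf_intervals S 0 1)"
    using assms(3,4) T(2) by (simp_all add: represents_iff_list_all2)
  show "f p = g p" if "p \<in> {0..1}" for p
    by (rule affine_onto_unique[OF fg partitions_unit_leaf_intervals[OF T(1) assms(2)] _ that]) simp
qed

text \<open>All points of the intervals lie in the unit interval, so passing to
  \<open>restrict\<close> or \<open>compose\<close> there is harmless.\<close>

lemma affine_onto_cong_unit:
  assumes "list_all2 (affine_onto f) Is Js" "partitions 0 Is 1"
    and "\<And>p. p \<in> {0..1} \<Longrightarrow> g p = f p"
  shows "list_all2 (affine_onto g) Is Js"
proof (rule list.rel_mono_strong[OF assms(1)])
  fix I J assume I: "I \<in> set Is" and a: "affine_onto f I J"
  show "affine_onto g I J"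
    unfolding affine_onto_def
  proof
    fix t :: real assume t: "t \<in> {0..1}"
    have b: "0 \<le> fst I" "fst I < snd I" "snd I \<le> 1" using partitions_bounds[OF assms(2) I] by auto
    have "fst I + t * (snd I - fst I) \<le> fst I + 1 * (snd I - fst I)"
      using t b by (intro add_left_mono mult_right_mono) auto
    also have "\<dots> \<le> 1" using b by simp
    finally have "fst I + t * (snd I - fst I) \<in> {0..1}" using t b by simp
    then show "g (fst I + t * (snd I - fst I)) = fst J + t * (snd J - fst J)"
      using assms(3) a t by (simp add: affine_onto_def)
  qed
qed

lemma ex_represents:
  assumes "tree_pair k n T S" "\<forall>j\<in>{1..k}. n j \<ge> 2"
  shows "\<exists>f. represents T S f"
proof -
  have T: "num_leaves T = num_leaves S" "partitions 0 (leaf_intervals T 0 1) 1"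
    "partitions 0 (leaf_intervals S 0 1) 1"
    using assms(1) partitions_unit_leaf_intervals[OF _ assms(2)]
    unfolding tree_pair_def by blast+
  obtain f where f: "list_all2 (affine_onto f) (leaf_intervals T 0 1) (leaf_intervals S 0 1)"
    using ex_piecewise_affine[OF _ T(2,3)] T(1) by auto
  have "represents T S (restrict f {0..1})"
    using T(1) affine_onto_cong_unit[OF f T(2), of "restrict f {0..1}"]
    by (simp add: represents_iff_list_all2)
  then show ?thesis by blast
qed

text \<open>The middle partition \<open>Js\<close> is only a list of intervals: in a product it is
  described by two trees at once, one for each factor.\<close>

lemma represents_compose:
  assumes "partitions 0 (leaf_intervals T 0 1) 1"
    and "list_all2 (affine_onto f) (leaf_intervals T 0 1) Js"
    and "list_all2 (affine_onto g) Js (leaf_intervals U 0 1)"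
    and "num_leaves T = num_leaves U"
  shows "represents T U (compose {0..1} g f)"
proof -
  have "list_all2 (affine_onto (g \<circ> f)) (leaf_intervals T 0 1) (leaf_intervals U 0 1)"
    by (rule list_all2_trans[OF _ assms(2,3)]) (auto simp: affine_onto_def)
  then have "list_all2 (affine_onto (compose {0..1} g f)) (leaf_intervals T 0 1) (leaf_intervals U 0 1)"
    by (rule affine_onto_cong_unit) (use assms in \<open>auto simp: compose_def\<close>)
  then show ?thesis using assms(4) by (simp add: represents_iff_list_all2)
qed

text \<open>Besides justifying inverses, this supplies membership in \<open>Bij\<close>, on which
  the multiplication of \<open>BijGroup\<close> is composition.\<close>

lemma represents_in_carrier:
  assumes "tree_pair k n T S" "\<forall>j\<in>{1..k}. n j \<ge> 2" "represents T S f"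
  shows "f \<in> carrier (F_group k n)"
proof -
  let ?I = "leaf_intervals T 0 1" and ?J = "leaf_intervals S 0 1"
  have nary: "nary_tree (n ` {1..k}) T" "nary_tree (n ` {1..k}) S"
    using assms(1) by (auto simp: tree_pair_def)
  have f: "list_all2 (affine_onto f) ?I ?J" "f \<in> extensional {0..1}"
    using assms by (auto simp: represents_iff_list_all2 tree_pair_def)
  have part: "partitions 0 ?I 1" "partitions 0 ?J 1"
    using partitions_unit_leaf_intervals[OF _ assms(2)] nary by blast+
  have f0: "f 0 = 0"
  proof (cases ?I)
    case (Cons I Is)
    then obtain J Js where J: "?J = J # Js" "affine_onto f I J" using f(1) by (auto simp: list_all2_Cons1)
    have "f (fst I + 0 * (snd I - fst I)) = fst J + 0 * (snd J - fst J)"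
      using J(2) unfolding affine_onto_def by (rule bspec) simp
    then show ?thesis using part Cons J by simp
  qed (use part in simp)
  have P: "f 1 = 1" "strict_mono_on {0..1} f" "continuous_on {0..1} f"
    using piecewise_affine_strict_mono_continuous[OF f(1) part f0] by auto
  have inj: "inj_on f {0..1}" using P(2) by (rule strict_mono_on_imp_inj_on)
  have image: "f ` {0..1} = {0..1}"
  proof
    show "f ` {0..1} \<subseteq> {0..1}"
      using P(1) f0 strict_mono_on_leD[OF P(2)] by force
    show "{0..1} \<subseteq> f ` {0..1}"
    proof
      fix y :: real assume "y \<in> {0..1}"
      then obtain x where "0 \<le> x" "x \<le> 1" "f x = y"
        using IVT'[of f 0 y 1] P f0 by auto
      then show "y \<in> f ` {0..1}" by auto
    qed
  qed
  have "f \<in> Bij {0..1}" using inj image f(2) by (simp add: Bij_def bij_betw_def)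
  moreover have "\<exists>g. homeomorphism {0..1} {0..1} f g"
    using homeomorphism_compact[OF compact_Icc P(3) image inj] by blast
  \<comment> \<open>The right endpoints of the domain leaves serve as the set of possible
    breakpoints.\<close>
  moreover have "finite (snd ` set ?I)" by simp
  moreover have "snd ` set ?I \<subseteq> localized_ints (\<Prod>j=1..k. n j)"
    using leaf_interval_endpoint(1)[OF assms(2) nary(1), of 0 1]
      int_in_localized_ints[of 0] int_in_localized_ints[of 1] by auto
  moreover have "\<exists>s\<in>slope_group k n. \<exists>c. \<forall>x\<in>{a..b}. f x = s * x + c"
    if ab: "0 \<le> a \<and> a < b \<and> b \<le> 1 \<and> {a<..<b} \<inter> snd ` set ?I = {}" for a b
  proof -
    obtain i where i: "i < length ?I" "fst (?I ! i) \<le> a" "b \<le> snd (?I ! i)"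
      using partitions_interval_containing[OF part(1)] ab by blast
    have len: "length ?J = length ?I" using assms(1) by (simp add: tree_pair_def)
    define s where "s = (snd (?J ! i) - fst (?J ! i)) / (snd (?I ! i) - fst (?I ! i))"
    have "s \<in> slope_group k n"
      unfolding s_def
    proof (rule slope_group_divide[OF assms(2)])
      show "snd (?J ! i) - fst (?J ! i) \<in> slope_group k n"
        using leaf_interval_width[OF nary(2) assms(2) one_in_slope_group] i(1) len by (metis nth_mem)
      show "snd (?I ! i) - fst (?I ! i) \<in> slope_group k n"
        using leaf_interval_width[OF nary(1) assms(2) one_in_slope_group] i(1) by (metis nth_mem)
    qed
    moreover have "f x = s * x + (fst (?J ! i) - s * fst (?I ! i))" if "x \<in> {a..b}" for x
    proof -
      have "affine_onto f (?I ! i) (?J ! i)" using f(1) i by (auto simp: list_all2_conv_all_nth)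
      then have "f x = s * (x - fst (?I ! i)) + fst (?J ! i)"
        unfolding s_def by (rule affine_onto_eval) (use i ab that in auto)
      then show ?thesis by (simp add: algebra_simps)
    qed
    ultimately show ?thesis by blast
  qed
  ultimately have "f \<in> {f \<in> Bij {0..1}.
        (\<exists>g. homeomorphism {0..1} {0..1} f g) \<and> strict_mono_on {0..1} f \<and>
        (\<exists>S. finite S \<and> S \<subseteq> localized_ints (\<Prod>j=1..k. n j) \<and>
           (\<forall>a b. 0 \<le> a \<and> a < b \<and> b \<le> 1 \<and> {a<..<b} \<inter> S = {} \<longrightarrow>
              (\<exists>s\<in>slope_group k n. \<exists>c. \<forall>x\<in>{a..b}. f x = s * x + c)))}"
    using P(2) by blast
  then show ?thesis by (simp add: F_group_def)
qed

section \<open>Products and inverses of represented maps\<close>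

text \<open>The range tree \<open>S\<close> of \<open>f\<close> and the domain tree
  \<open>T'\<close> of \<open>g\<close> are refined to a common partition. Trees added to
  \<open>S\<close> are also added to \<open>T\<close>, and those added to \<open>T'\<close> also to
  \<open>S'\<close>. The constant comes from \<open>T'\<close> alone.\<close>

lemma compose_diagram_bound:
  assumes "\<forall>j\<in>{1..k}. n j \<ge> 2" "tree_pair k n T' S'" "represents T' S' g"
  shows "\<exists>C. \<forall>f T S. tree_pair k n T S \<and> represents T S f \<longrightarrow>
    (\<exists>U V. tree_pair k n U V \<and> represents U V (compose {0..1} g f) \<and>
      num_leaves U \<le> C * num_leaves T)"
proof -
  let ?N = "n ` {1..k}"
  have N: "\<forall>q\<in>?N. q > 0" using assms(1) by force
  obtain C where C: "\<And>s. nary_tree ?N s \<Longrightarrow> \<exists>us vs. length us = num_leaves s \<and>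
    length vs = num_leaves T' \<and> (\<forall>u\<in>set us \<union> set vs. nary_tree ?N u) \<and>
    (\<forall>a w. subdivide (leaf_intervals s a w) us = subdivide (leaf_intervals T' a w) vs) \<and>
    sum_list (map num_leaves us) \<le> C * num_leaves s"
    using common_refinement[OF N, of T'] assms(2) by (auto simp: tree_pair_def)
  have "\<exists>U V. tree_pair k n U V \<and> represents U V (compose {0..1} g f) \<and>
      num_leaves U \<le> C * num_leaves T"
    if TS: "tree_pair k n T S" and f: "represents T S f" for f T S
  proof -
    have S: "nary_tree ?N S" "nary_tree ?N T" "num_leaves T = num_leaves S"
      using TS by (auto simp: tree_pair_def)
    have S': "nary_tree ?N S'" "num_leaves T' = num_leaves S'"
      using assms by (auto simp: tree_pair_def)
    obtain us vs where uv: "length us = num_leaves S" "length vs = num_leaves T'"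
      "\<forall>u\<in>set us \<union> set vs. nary_tree ?N u"
      "\<And>a w. subdivide (leaf_intervals S a w) us = subdivide (leaf_intervals T' a w) vs"
      "sum_list (map num_leaves us) \<le> C * num_leaves S"
      using C[OF S(1)] by blast
    let ?U = "graft T us" and ?V = "graft S' vs"
    have U: "nary_tree ?N ?U" "nary_tree ?N ?V"
      using nary_graft[OF S(2)] nary_graft[OF S'(1)] S(3) S'(2) uv(1-3) by simp_all
    have "list_all2 (affine_onto f) (leaf_intervals ?U 0 1) (subdivide (leaf_intervals S 0 1) us)"
      using f S(3) uv(1) by (simp add: represents_iff_list_all2 leaf_intervals_graft
          affine_onto_subdivide)
    moreover have "list_all2 (affine_onto g) (subdivide (leaf_intervals S 0 1) us)
        (leaf_intervals ?V 0 1)"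
      using assms(3) S'(2) uv(2) by (simp add: represents_iff_list_all2 leaf_intervals_graft
          affine_onto_subdivide uv(4))
    ultimately have l: "num_leaves ?U = num_leaves ?V"
      by (metis length_leaf_intervals list_all2_lengthD)
    have "represents ?U ?V (compose {0..1} g f)"
      using partitions_unit_leaf_intervals[OF U(1) assms(1)] l \<open>list_all2 (affine_onto f) _ _\<close>
        \<open>list_all2 (affine_onto g) _ _\<close> by (intro represents_compose)
    moreover have "tree_pair k n ?U ?V" using U l by (simp add: tree_pair_def)
    moreover have "num_leaves ?U \<le> C * num_leaves T"
      using uv S by (simp add: num_leaves_graft)
    ultimately show ?thesis by blast
  qed
  then show ?thesis by blast
qed


lemma mult_F_group:
  assumes "x \<in> Bij {0..1}" "y \<in> Bij {0..1}"
  shows "x \<otimes>\<^bsub>F_group k n\<^esub> y = compose {0..1} x y"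
  using assms by (simp add: F_group_def BijGroup_def)

lemma carrier_F_group_subset_Bij: "carrier (F_group k n) \<subseteq> Bij {0..1}"
  by (auto simp: F_group_def)

text \<open>Exchanging the two trees inverts the map: each composite represents a pair of equal
  trees, as the identity does, and representation is unique.\<close>

lemma m_inv_diagram:
  assumes "tree_pair k n T S" "\<forall>j\<in>{1..k}. n j \<ge> 2" "represents T S f"
  shows "represents S T (m_inv (F_group k n) f)"
proof -
  have ST: "tree_pair k n S T" using assms(1) by (simp add: tree_pair_def)
  obtain h where h: "represents S T h" using ex_represents[OF ST assms(2)] by blast
  have carrier: "f \<in> carrier (F_group k n)" "h \<in> carrier (F_group k n)"
    using represents_in_carrier[OF assms] represents_in_carrier[OF ST assms(2) h] .
  have Bij: "y \<in> Bij {0..1}" if "y \<in> carrier (F_group k n)" for y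
    using that carrier_F_group_subset_Bij by blast
  have one: "\<one>\<^bsub>F_group k n\<^esub> = (\<lambda>x\<in>{0..1}. x)" by (simp add: F_group_def BijGroup_def)
  have id: "compose {0..1} g f = (\<lambda>x\<in>{0..1}. x)"
    if U: "tree_pair k n U V" and f: "represents U V f" and g: "represents V U g" for U V f g
  proof -
    have t: "nary_tree (n ` {1..k}) U" "num_leaves U = num_leaves V" "tree_pair k n U U"
      using U by (auto simp: tree_pair_def)
    note part = partitions_unit_leaf_intervals[OF t(1) assms(2)]
    have "list_all2 (affine_onto f) (leaf_intervals U 0 1) (leaf_intervals V 0 1)"
      and "list_all2 (affine_onto g) (leaf_intervals V 0 1) (leaf_intervals U 0 1)"
      using f g t(2) by (simp_all add: represents_iff_list_all2)
    then have "represents U U (compose {0..1} g f)"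
      by (rule represents_compose[OF part]) simp
    moreover have "list_all2 (affine_onto (\<lambda>x. x)) (leaf_intervals U 0 1) (leaf_intervals U 0 1)"
      by (rule list_all2_refl) (simp add: affine_onto_def)
    then have "list_all2 (affine_onto (\<lambda>x\<in>{0..1}. x)) (leaf_intervals U 0 1) (leaf_intervals U 0 1)"
      by (rule affine_onto_cong_unit[OF _ part]) simp
    then have "represents U U (\<lambda>x\<in>{0..1}. x)" by (simp add: represents_iff_list_all2)
    ultimately show ?thesis using represents_unique[OF t(3) assms(2)] by blast
  qed
  have hf: "compose {0..1} h f = (\<lambda>x\<in>{0..1}. x)" using id[OF assms(1,3) h] .
  have fh: "compose {0..1} f h = (\<lambda>x\<in>{0..1}. x)" using id[OF ST h assms(3)] .
  have "m_inv (F_group k n) f = h"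
    unfolding m_inv_def
  proof (rule the_equality)
    show "h \<in> carrier (F_group k n) \<and> f \<otimes>\<^bsub>F_group k n\<^esub> h = \<one>\<^bsub>F_group k n\<^esub> \<and>
        h \<otimes>\<^bsub>F_group k n\<^esub> f = \<one>\<^bsub>F_group k n\<^esub>"
      using carrier Bij mult_F_group one hf fh by simp
    fix y assume y: "y \<in> carrier (F_group k n) \<and> f \<otimes>\<^bsub>F_group k n\<^esub> y = \<one>\<^bsub>F_group k n\<^esub> \<and>
        y \<otimes>\<^bsub>F_group k n\<^esub> f = \<one>\<^bsub>F_group k n\<^esub>"
    then have yf: "compose {0..1} y f = (\<lambda>x\<in>{0..1}. x)" and yB: "y \<in> Bij {0..1}"
      using carrier Bij mult_F_group one by auto
    have hB: "h \<in> Bij {0..1}" using Bij carrier by blast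
    \<comment> \<open>For a competing inverse \<open>y\<close>, evaluate \<open>y (f (h p))\<close>
      in two ways.\<close>
    show "y = h"
    proof (rule extensionalityI)
      show "y \<in> extensional {0..1}" "h \<in> extensional {0..1}"
        using yB hB by (auto simp: Bij_def)
      fix p :: real assume p: "p \<in> {0..1}"
      have hp: "h p \<in> {0..1}" using hB p by (auto simp: Bij_def bij_betw_def)
      have "f (h p) = p" using fun_cong[OF fh, of p] p by (simp add: compose_def)
      moreover have "y (f (h p)) = h p" using fun_cong[OF yf, of "h p"] hp by (simp add: compose_def)
      ultimately show "y p = h p" by simp
    qed
  qed
  then show ?thesis using h by simp
qed

section \<open>Diagrams of the standard generators\<close>

lemma num_leaves_right_string: "num_leaves (right_string m i) = i * (m - 1) + 1"
  by (induction i) (simp_all add: sum_list_replicate)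

lemma nary_right_string: "m \<in> N \<Longrightarrow> m > 0 \<Longrightarrow> nary_tree N (right_string m i)"
  by (induction i) simp_all

text \<open>One leaf is replaced by \<open>m\<close> leaves; adding 1 on the left avoids truncated
  subtraction.\<close>

lemma num_leaves_attach_caret:
  "i < num_leaves t \<Longrightarrow> num_leaves (attach_caret m t i) + 1 = num_leaves t + m"
  and "i < sum_list (map num_leaves ts) \<Longrightarrow>
    sum_list (map num_leaves (attach_caret_list m ts i)) + 1 = sum_list (map num_leaves ts) + m"
proof (induction m t i and m ts i rule: attach_caret_attach_caret_list.induct)
  case (4 m t ts i)
  show ?case
  proof (cases "i < num_leaves t")
    case True
    then show ?thesis using 4(1)[OF True True] by simp
  next
    case False
    then have "i - num_leaves t < sum_list (map num_leaves ts)" using 4(3) by simp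
    then show ?thesis using 4(2)[OF False] False by simp
  qed
qed (simp_all add: sum_list_replicate)

lemma length_attach_caret_list [simp]: "length (attach_caret_list m ts i) = length ts"
  by (induction ts arbitrary: i) auto

lemma nary_attach_caret:
  "nary_tree N t \<Longrightarrow> m \<in> N \<Longrightarrow> nary_tree N (attach_caret m t i)"
  and "\<forall>t\<in>set ts. nary_tree N t \<Longrightarrow> m \<in> N \<Longrightarrow> \<forall>t\<in>set (attach_caret_list m ts i). nary_tree N t"
proof (induction m t i and m ts i rule: attach_caret_attach_caret_list.induct)
  case (4 m t ts i)
  have t: "nary_tree N t" and ts: "\<forall>t\<in>set ts. nary_tree N t" using 4(3) by simp_all
  show ?case
  proof (cases "i < num_leaves t")
    case True
    then show ?thesis using 4(1)[OF True t 4(4)] ts by simp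
  next
    case False
    then show ?thesis using 4(2)[OF False ts 4(4)] t by simp
  qed
qed simp_all

text \<open>Covers both families of generators. The bound on \<open>p\<close> says that this leaf
  exists, the string having \<open>i * (n 1 - 1) + 1\<close> leaves. Divisibility makes the division
  in \<open>string_to\<close> exact, so both trees have equally many leaves.\<close>

lemma string_to_diagram:
  assumes "k \<ge> 1" "\<forall>j\<in>{1..k}. n j \<ge> 2" "\<forall>j\<in>{1..k}. (n 1 - 1) dvd (n j - 1)"
    and "j \<in> {1..k}" "p \<le> i * (n 1 - 1)"
  shows "\<exists>T S. tree_pair k n T S \<and>
    represents T S (string_to n (attach_caret (n j) (right_string (n 1) i) p))"
proof -
  let ?N = "n ` {1..k}" and ?S = "attach_caret (n j) (right_string (n 1) i) p"
  let ?T = "right_string (n 1) ((num_leaves ?S - 1) div (n 1 - 1))"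
  have one: "1 \<in> {1..k}" using assms(1) by simp
  have n1: "n 1 \<in> ?N" "n 1 > 0" using one assms(2) by (blast, fastforce)
  have nj: "n j \<in> ?N" "n j \<ge> 2" using assms(2,4) by blast+
  have T: "nary_tree ?N ?T" and S: "nary_tree ?N ?S"
    using nary_right_string[OF n1] nary_attach_caret(1)[OF _ nj(1)] by blast+
  have "num_leaves ?S + 1 = i * (n 1 - 1) + 1 + n j"
    using num_leaves_attach_caret(1)[of p "right_string (n 1) i" "n j"] assms(5)
    by (simp add: num_leaves_right_string)
  then have l: "num_leaves ?S = i * (n 1 - 1) + (n j - 1) + 1" using nj by simp
  have "(n 1 - 1) dvd (num_leaves ?S - 1)" using l assms(3,4) by simp
  then have "(num_leaves ?S - 1) div (n 1 - 1) * (n 1 - 1) = num_leaves ?S - 1"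
    by (rule dvd_div_mult_self)
  then have "num_leaves ?T = num_leaves ?S"
    unfolding num_leaves_right_string using l by linarith
  then have TS: "tree_pair k n ?T ?S" using T S by (simp add: tree_pair_def)
  have "\<exists>!f. represents ?T ?S f"
    using ex_represents[OF TS assms(2)] represents_unique[OF TS assms(2)] by blast
  then have "represents ?T ?S (string_to n ?S)" unfolding string_to_def by (rule theI')
  then show ?thesis using TS by blast
qed

lemma standard_gens_diagram:
  assumes "k \<ge> 1" "\<forall>j\<in>{1..k}. n j \<ge> 2" "\<forall>j\<in>{1..k}. (n 1 - 1) dvd (n j - 1)"
    and "g \<in> standard_gens k n"
  shows "\<exists>T S. tree_pair k n T S \<and> represents T S g"
proof -
  consider (y) j i where "j \<in> {1..k}" "g = y_gen n j i" | (z) j i where "j \<in> {1..k}" "g = z_gen n j i"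
  proof -
    from assms(4) consider j i where "j \<in> {2..k}" "g = y_gen n j i"
      | j i where "j \<in> {1..k}" "g = z_gen n j i"
      unfolding standard_gens_def by blast
    then show ?thesis
    proof cases
      case 1
      then show ?thesis by (intro that(1)) auto
    qed (rule that(2))
  qed
  then show ?thesis
  proof cases
    case (y j i)
    then have "g = string_to n (attach_caret (n j) (right_string (n 1) i) (i * (n 1 - 1)))"
      by (simp add: y_gen_def num_leaves_right_string Let_def)
    then show ?thesis using string_to_diagram[OF assms(1-3) y(1) order_refl] by simp
  next
    case (z j i)
    have "n 1 \<ge> 2" using assms(1,2) by simp
    then have "n 1 - 1 > 0" by simp
    \<comment> \<open>The string in \<open>z_gen\<close> is long enough to have a leaf numbered
      \<open>i\<close>.\<close>
    then have "i < (i div (n 1 - 1) + 1) * (n 1 - 1)"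
      using dividend_less_div_times[of "n 1 - 1" i] by simp
    then show ?thesis
      using string_to_diagram[OF assms(1-3) z(1), of i "i div (n 1 - 1) + 1"] z(2)
      by (simp add: z_gen_def)
  qed
qed

lemma finite_standard_gens: "finite (standard_gens k n)"
proof -
  have "standard_gens k n \<subseteq> (\<lambda>(j, i). y_gen n j i) ` (SIGMA j:{2..k}. {..<n j}) \<union>
      (\<lambda>(j, i). z_gen n j i) ` (SIGMA j:{1..k}. {..<n j})"
    by (auto simp: standard_gens_def)
  then show ?thesis by (rule finite_subset) auto
qed

section \<open>Leaf counts along words\<close>

text \<open>A given diagram yields a least leaf count, and all minimal diagrams share it, so the
  definite description in \<open>min_leaves\<close> denotes it.\<close>

lemma min_leaves_le:
  assumes "tree_pair k n T S" "represents T S x"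
  shows "min_leaves k n x \<le> num_leaves T"
proof -
  let ?P = "\<lambda>l. \<exists>T S. tree_pair k n T S \<and> represents T S x \<and> num_leaves T = l"
  define l where "l = (LEAST l. ?P l)"
  have "?P l" unfolding l_def by (rule LeastI[of ?P "num_leaves T"]) (use assms in blast)
  moreover have le: "l \<le> num_leaves T'" if "tree_pair k n T' S'" "represents T' S' x" for T' S'
    unfolding l_def by (rule Least_le) (use that in blast)
  ultimately have "\<exists>T S. minimal_diagram k n x T S \<and> num_leaves T = l"
    unfolding minimal_diagram_def by blast
  then have "min_leaves k n x = l"
    unfolding min_leaves_def
  proof (rule the_equality)
    fix l' assume "\<exists>T S. minimal_diagram k n x T S \<and> num_leaves T = l'"
    moreover obtain T0 S0 where "minimal_diagram k n x T0 S0" "num_leaves T0 = l"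
      using \<open>\<exists>T S. minimal_diagram k n x T S \<and> num_leaves T = l\<close> by blast
    ultimately show "l' = l" unfolding minimal_diagram_def by (meson le_antisym)
  qed
  then show ?thesis using le[OF assms] by simp
qed

text \<open>\<open>foldr\<close> multiplies by the first letter last and on the left, so each
  induction step composes with one letter and costs one factor \<open>B\<close>.\<close>

lemma word_diagram_bound:
  assumes "\<forall>j\<in>{1..k}. n j \<ge> 2"
    and "\<And>g. g \<in> set w \<Longrightarrow> g \<in> Bij {0..1}"
    and "\<And>g f T S. g \<in> set w \<Longrightarrow> tree_pair k n T S \<Longrightarrow> represents T S f \<Longrightarrow>
      \<exists>U V. tree_pair k n U V \<and> represents U V (compose {0..1} g f) \<and>
        num_leaves U \<le> B * num_leaves T"
  shows "\<exists>T S. tree_pair k n T S \<and>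
    represents T S (foldr (mult (F_group k n)) w (one (F_group k n))) \<and>
    num_leaves T \<le> B ^ length w"
  using assms(2,3)
proof (induction w)
  case Nil
  \<comment> \<open>The empty word is the identity, given by two one-leaf trees, matching
    \<open>B ^ 0 = 1\<close>.\<close>
  have "represents Leaf Leaf (one (F_group k n))"
    by (simp add: represents_def F_group_def BijGroup_def)
  then have "tree_pair k n Leaf Leaf \<and>
      represents Leaf Leaf (foldr (mult (F_group k n)) [] (one (F_group k n))) \<and>
      num_leaves Leaf \<le> B ^ length []"
    by (simp add: tree_pair_def)
  then show ?case by blast
next
  case (Cons g w)
  let ?f = "foldr (mult (F_group k n)) w (one (F_group k n))"
  have "\<exists>T S. tree_pair k n T S \<and> represents T S ?f \<and> num_leaves T \<le> B ^ length w"
  proof (rule Cons.IH)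
    show "h \<in> Bij {0..1}" if "h \<in> set w" for h
      by (rule Cons.prems(1)) (simp add: that)
    show "\<exists>U V. tree_pair k n U V \<and> represents U V (compose {0..1} h f) \<and>
        num_leaves U \<le> B * num_leaves T"
      if "h \<in> set w" "tree_pair k n T S" "represents T S f" for h f T S
      by (rule Cons.prems(2)[OF list.set_intros(2)[OF that(1)] that(2,3)])
  qed
  then obtain T S where
    TS: "tree_pair k n T S" "represents T S ?f" "num_leaves T \<le> B ^ length w"
    by blast
  have "?f \<in> Bij {0..1}"
    using represents_in_carrier[OF TS(1) assms(1) TS(2)] carrier_F_group_subset_Bij by blast
  moreover have "g \<in> Bij {0..1}" by (rule Cons.prems(1)) simp
  ultimately have f: "foldr (mult (F_group k n)) (g # w) (one (F_group k n)) = compose {0..1} g ?f"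
    by (simp only: foldr.simps o_apply mult_F_group)
  obtain U V where UV: "tree_pair k n U V" "represents U V (compose {0..1} g ?f)"
    "num_leaves U \<le> B * num_leaves T"
    using Cons.prems(2)[OF list.set_intros(1) TS(1,2)] by blast
  have "B * num_leaves T \<le> B ^ length (g # w)" using TS(3) by simp
  with UV(3) have "num_leaves U \<le> B ^ length (g # w)" by (rule order_trans)
  then show ?case unfolding f using UV(1,2) by blast
qed

theorem theorem5p3:
  fixes k :: nat and n :: "nat \<Rightarrow> nat"
  assumes "k \<ge> 1"
    and "\<forall>j\<in>{1..k}. n j \<ge> 2"
    and "\<forall>j\<in>{1..k}. (n 1 - 1) dvd (n j - 1)"
  shows "\<exists>B::nat. B \<ge> 2 \<and>
    (\<forall>x\<in>carrier (F_group k n).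
       ereal_of_enat (word_length (F_group k n) (standard_gens k n) x)
         \<ge> ereal (log (real B) (real (min_leaves k n x))))"
proof -
  let ?F = "F_group k n" and ?X = "standard_gens k n"
  let ?A = "?X \<union> m_inv ?F ` ?X"
  have diagram: "\<exists>T S. tree_pair k n T S \<and> represents T S g" if g: "g \<in> ?A" for g
  proof (cases "g \<in> ?X")
    case True
    then show ?thesis using standard_gens_diagram assms by blast
  next
    case False
    then obtain h where h: "h \<in> ?X" "g = m_inv ?F h" using g by blast
    then obtain T S where TS: "tree_pair k n T S" "represents T S h"
      using standard_gens_diagram assms by blast
    then have "represents S T g" using m_inv_diagram[OF _ assms(2)] h(2) by blast
    moreover have "tree_pair k n S T" using TS(1) by (simp add: tree_pair_def)
    ultimately show ?thesis by blast
  qed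
  define composes where "composes g C \<longleftrightarrow> (\<forall>f T S. tree_pair k n T S \<and> represents T S f \<longrightarrow>
    (\<exists>U V. tree_pair k n U V \<and> represents U V (compose {0..1} g f) \<and>
      num_leaves U \<le> C * num_leaves T))" for g C
  have "\<exists>C. composes g C" if g: "g \<in> ?A" for g
  proof -
    obtain T S where "tree_pair k n T S" "represents T S g" using diagram[OF g] by blast
    then show ?thesis unfolding composes_def by (rule compose_diagram_bound[OF assms(2)])
  qed
  then have "\<forall>g\<in>?A. \<exists>C. composes g C" by blast
  then obtain C where "\<forall>g\<in>?A. composes g (C g)" using bchoice by blast
  then have C: "\<exists>U V. tree_pair k n U V \<and> represents U V (compose {0..1} g f) \<and>
      num_leaves U \<le> C g * num_leaves T"
    if "g \<in> ?A" "tree_pair k n T S" "represents T S f" for g f T S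
    using that unfolding composes_def by blast
  \<comment> \<open>The set of generators and inverses is finite, so the sum dominates every
    \<open>C g\<close>; the summand 2 makes \<open>B\<close> an admissible base of the
    logarithm.\<close>
  define B where "B = 2 + (\<Sum>g\<in>?A. C g)"
  have B: "B \<ge> 2" by (simp add: B_def)
  have CB: "C g \<le> B" if "g \<in> ?A" for g
    using member_le_sum[of g ?A C] that finite_standard_gens[of k n] by (simp add: B_def)
  have bound: "\<exists>U V. tree_pair k n U V \<and> represents U V (compose {0..1} g f) \<and>
      num_leaves U \<le> B * num_leaves T"
    if g: "g \<in> ?A" and f: "tree_pair k n T S" "represents T S f" for g f T S
  proof -
    obtain U V where "tree_pair k n U V" "represents U V (compose {0..1} g f)"
      "num_leaves U \<le> C g * num_leaves T"
      using C[OF g f] by blast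
    moreover have "C g * num_leaves T \<le> B * num_leaves T"
      using CB[OF g] by (rule mult_right_mono) simp
    ultimately show ?thesis using order_trans by blast
  qed
  have Bij: "g \<in> Bij {0..1}" if "g \<in> ?A" for g
    using diagram[OF that] represents_in_carrier[OF _ assms(2)] carrier_F_group_subset_Bij by blast
  have "ereal_of_enat (word_length ?F ?X x) \<ge> ereal (log (real B) (real (min_leaves k n x)))" for x
  proof -
    let ?W = "{w. set w \<subseteq> ?A \<and> foldr (mult ?F) w (one ?F) = x}"
    show ?thesis
    proof (cases "?W = {}")
      case True
      \<comment> \<open>If no word gives \<open>x\<close>, the infimum is over the empty set and the
        inequality is trivial.\<close>
      then have "word_length ?F ?X x = \<infinity>"
        unfolding word_length_def True by (simp add: top_enat_def)
      then show ?thesis by simp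
    next
      case False
      then obtain v where "v \<in> ?W" by blast
      then have "enat (length v) \<in> (\<lambda>w. enat (length w)) ` ?W" by (rule imageI)
      \<comment> \<open>The order on \<open>enat\<close> is a well-order, so the infimum is attained
        by a shortest word.\<close>
      then have "word_length ?F ?X x \<in> (\<lambda>w. enat (length w)) ` ?W"
        unfolding word_length_def by (rule wellorder_InfI)
      then obtain w where w: "set w \<subseteq> ?A" "foldr (mult ?F) w (one ?F) = x"
        "word_length ?F ?X x = enat (length w)" by blast
      have "\<exists>T S. tree_pair k n T S \<and> represents T S (foldr (mult ?F) w (one ?F)) \<and>
          num_leaves T \<le> B ^ length w"
      proof (rule word_diagram_bound[OF assms(2)])
        show "g \<in> Bij {0..1}" if "g \<in> set w" for g using that w(1) Bij by blast
        show "\<exists>U V. tree_pair k n U V \<and> represents U V (compose {0..1} g f) \<and>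
            num_leaves U \<le> B * num_leaves T"
          if "g \<in> set w" "tree_pair k n T S" "represents T S f" for g f T S
          using bound[OF _ that(2,3)] that(1) w(1) by blast
      qed
      then obtain T S where "tree_pair k n T S" "represents T S x" "num_leaves T \<le> B ^ length w"
        unfolding w(2) by blast
      then have L: "min_leaves k n x \<le> B ^ length w" using min_leaves_le order_trans by blast
      have "log (real B) (real (min_leaves k n x)) \<le> real (length w)"
      \<comment> \<open>Monotonicity of the logarithm needs a positive argument. In the zero case
        the logarithm is 0 by the convention \<open>ln 0 = 0\<close>.\<close>
      proof (cases "min_leaves k n x = 0")
        case False
        have "real (min_leaves k n x) \<le> real B ^ length w"
          using L by (simp flip: of_nat_power)
        then have "log (real B) (real (min_leaves k n x)) \<le> log (real B) (real B ^ length w)"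
          using False B by (intro log_mono) simp_all
        also have "\<dots> = real (length w)" using B by (simp add: log_nat_power)
        finally show ?thesis .
      qed (simp add: log_def)
      then show ?thesis using w(3) by simp
    qed
  qed
  then show ?thesis using B by blast
qed

end
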